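(* Let $s\geq 5$ be an integer congruent to $3$ or $5$ modulo $6$, let $S$ be a Steiner triple system on $[s-2]$, and let $n\in\mathbb{N}$. Let $G_S$ be the 3-graph on $[n]$ built from $S$ and a balanced partition $[n]=\bigsqcup_{i=1}^{s-2}V_i$ as described in the context. Then $G_S$ is $K_s$-free and has minimum codegree \[\delta_2(G_S)=\left(1-\frac{1}{s-2}\right)n+O(1),\] where $s$ is fixed, $n\to\infty$, and the implied constant depends only on $s$.
   Context: A 3-graph is a pair $G=(V,E)$ with $V$ a finite vertex set and $E$ a set of 3-element subsets of $V$ (the 3-edges). The codegree $d(x,y)$ of two distinct vertices is the number of 3-edges containing both, and $\delta_2(G)$ is the minimum of $d(x,y)$ over all pairs of distinct vertices. $K_s$ denotes the complete 3-graph on $s$ vertices; $G$ is $K_s$-free if no $s$ vertices of $G$ have all their triples in $E$. Write $[m]=\{1,\dots,m\}$. A Steiner triple system on $[m]$ is a 3-graph on vertex set $[m]$ in which every pair of distinct vertices is contained in exactly one 3-edge. Construction of $G_S$: given a Steiner triple system $S$ on $[s-2]$ and $n\in\mathbb{N}$, let $[n]=\bigsqcup_{i=1}^{s-2}V_i$ be a balanced partition (part sizes differ by at most $1$). The 3-graph $G_S$ has vertex set $[n]$, and its 3-edges are exactly: (i) all triples with two vertices in $V_i$ and one vertex in $V_j$, for distinct $i,j\in[s-2]$; (ii) all triples with one vertex in each of $V_i,V_j,V_k$, for distinct $i,j,k\in[s-2]$ such that $ijk$ is not a 3-edge of $S$. *)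

theory Defs
  imports Complex_Main "HOL-Library.Disjoint_Sets"
begin

text \<open>A 3-graph is represented as a pair of its vertex set and its edge set.\<close>

type_synonym 'a hypergraph = "'a set \<times> 'a set set"

abbreviation verts :: "'a hypergraph \<Rightarrow> 'a set" where
  "verts G \<equiv> fst G"

abbreviation edges :: "'a hypergraph \<Rightarrow> 'a set set" where
  "edges G \<equiv> snd G"

definition three_graph :: "'a hypergraph \<Rightarrow> bool" where
  "three_graph G \<longleftrightarrow> finite (verts G) \<and> (\<forall>e \<in> edges G. e \<subseteq> verts G \<and> card e = 3)"

definition codegree :: "'a hypergraph \<Rightarrow> 'a \<Rightarrow> 'a \<Rightarrow> nat" where
  "codegree G x y = card {e \<in> edges G. x \<in> e \<and> y \<in> e}"

text \<open>Meaningful only if there are at least two vertices; otherwise this is \<open>Min {}\<close>.\<close>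

definition min_codegree :: "'a hypergraph \<Rightarrow> nat" where
  "min_codegree G = Min {codegree G x y | x y. x \<in> verts G \<and> y \<in> verts G \<and> x \<noteq> y}"

definition clique_free :: "nat \<Rightarrow> 'a hypergraph \<Rightarrow> bool" where
  "clique_free s G \<longleftrightarrow>
     \<not> (\<exists>A. A \<subseteq> verts G \<and> finite A \<and> card A = s \<and> (\<forall>T. T \<subseteq> A \<and> card T = 3 \<longrightarrow> T \<in> edges G))"

definition steiner_triple_system :: "nat \<Rightarrow> nat hypergraph \<Rightarrow> bool" where
  "steiner_triple_system m S \<longleftrightarrow>
     three_graph S \<and> verts S = {1..m} \<and>
     (\<forall>x \<in> {1..m}. \<forall>y \<in> {1..m}. x \<noteq> y \<longrightarrow> (\<exists>!e. e \<in> edges S \<and> x \<in> e \<and> y \<in> e))"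

text \<open>Parts may be empty, which is unavoidable when \<open>n < m\<close>.\<close>

definition balanced_partition :: "nat \<Rightarrow> nat \<Rightarrow> (nat \<Rightarrow> nat set) \<Rightarrow> bool" where
  "balanced_partition n m V \<longleftrightarrow>
     (\<Union>i\<in>{1..m}. V i) = {1..n} \<and> disjoint_family_on V {1..m} \<and>
     (\<forall>i \<in> {1..m}. \<forall>j \<in> {1..m}. card (V i) \<le> card (V j) + 1)"

definition steiner_blowup ::
  "nat \<Rightarrow> nat hypergraph \<Rightarrow> nat \<Rightarrow> (nat \<Rightarrow> nat set) \<Rightarrow> nat hypergraph" where
  "steiner_blowup m S n V =
    ({1..n},
     {{x, y, z} | x y z i j.
        i \<in> {1..m} \<and> j \<in> {1..m} \<and> i \<noteq> j \<and>
        x \<in> V i \<and> y \<in> V i \<and> x \<noteq> y \<and> z \<in> V j} \<union>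
     {{x, y, z} | x y z i j k.
        i \<in> {1..m} \<and> j \<in> {1..m} \<and> k \<in> {1..m} \<and>
        i \<noteq> j \<and> i \<noteq> k \<and> j \<noteq> k \<and> {i, j, k} \<notin> edges S \<and>
        x \<in> V i \<and> y \<in> V j \<and> z \<in> V k})"

lemma three_graph_steiner_blowup:
  assumes "balanced_partition n m V"
  shows "three_graph (steiner_blowup m S n V)"
proof -
  have sub: "x \<in> {1..n}" if "i \<in> {1..m}" "x \<in> V i" for i x
    using assms that unfolding balanced_partition_def by blast
  have ne: "x \<noteq> y" if "i \<in> {1..m}" "j \<in> {1..m}" "i \<noteq> j" "x \<in> V i" "y \<in> V j" for i j x y
    using assms that unfolding balanced_partition_def disjoint_family_on_def by blast
  have c3: "card {x, y, z} = 3" if "x \<noteq> y" "x \<noteq> z" "y \<noteq> z" for x y z :: nat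
    using that by simp
  have "e \<subseteq> {1..n} \<and> card e = 3" if "e \<in> edges (steiner_blowup m S n V)" for e
    using that unfolding steiner_blowup_def snd_conv
  proof (elim UnE CollectE exE conjE)
    fix x y z i j
    assume h: "e = {x, y, z}" "i \<in> {1..m}" "j \<in> {1..m}" "i \<noteq> j"
      "x \<in> V i" "y \<in> V i" "x \<noteq> y" "z \<in> V j"
    have "card e = 3"
      unfolding h(1) by (rule c3) (use h ne in blast)+
    moreover have "e \<subseteq> {1..n}"
      unfolding h(1) using h sub by blast
    ultimately show ?thesis by blast
  next
    fix x y z i j k
    assume h: "e = {x, y, z}" "i \<in> {1..m}" "j \<in> {1..m}" "k \<in> {1..m}"
      "i \<noteq> j" "i \<noteq> k" "j \<noteq> k" "x \<in> V i" "y \<in> V j" "z \<in> V k"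
    have "card e = 3"
      unfolding h(1) by (rule c3) (use h ne in blast)+
    moreover have "e \<subseteq> {1..n}"
      unfolding h(1) using h sub by blast
    ultimately show ?thesis by blast
  qed
  then show ?thesis
    unfolding three_graph_def by (auto simp: steiner_blowup_def)
qed

end

theory Submission
  imports Defs
begin

text \<open>
  A set of at most two vertices per part spans at least half as many parts as it has vertices, while
  an independent set \<open>I\<close> of a Steiner triple system on \<open>m\<close> points has \<open>2 |I| \<le> m + 1\<close>: for a fixed
  \<open>i \<in> I\<close>, the third points of the triples through \<open>i\<close> and the other points of \<open>I\<close> are distinct and lie
  outside \<open>I\<close>. So a clique has at most \<open>m + 1\<close> vertices. For the codegree, each pair of vertices
  has exactly one part \<open>V k\<close> that contributes nothing: the common part, or the part of the
  third point of the triple through the two parts.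
\<close>

section \<open>Third points and independent sets in a Steiner triple system\<close>

text \<open>The unique triple through \<open>i\<close> and \<open>j\<close> has exactly one further
  element. The equivalence ranges over all \<open>l\<close>, even \<open>l = i\<close> or
  \<open>l = j\<close>: then \<open>{i, j, l}\<close> has only two elements, so it is not an edge
  and differs from the triple.\<close>

lemma steiner_third_point:
  assumes "steiner_triple_system m S" "i \<in> {1..m}" "j \<in> {1..m}" "i \<noteq> j"
  obtains k where "k \<in> {1..m}" "k \<noteq> i" "k \<noteq> j" "\<And>l. {i, j, l} \<in> edges S \<longleftrightarrow> l = k"
proof -
  have S: "\<exists>!e. e \<in> edges S \<and> i \<in> e \<and> j \<in> e"
    and E: "\<And>e. e \<in> edges S \<Longrightarrow> e \<subseteq> {1..m} \<and> card e = 3"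
    using assms unfolding steiner_triple_system_def three_graph_def by blast+
  then obtain e where e: "e \<in> edges S" "i \<in> e" "j \<in> e" by blast
  have "card (e - {i, j}) = 1"
    using E[OF e(1)] e assms(4) by (simp add: card_Diff_subset)
  then obtain k where k: "e - {i, j} = {k}" by (auto simp: card_1_singleton_iff)
  then have ek: "e = {i, j, k}" "k \<noteq> i" "k \<noteq> j" using e by auto
  show thesis
  proof (rule that[of k])
    show "k \<in> {1..m}" using E[OF e(1)] k by blast
    show "{i, j, l} \<in> edges S \<longleftrightarrow> l = k" for l
    proof
      assume l: "{i, j, l} \<in> edges S"
      then have "{i, j, l} = e" using S e by blast
      then show "l = k" using k E[OF l] assms(4) by (cases "l = i \<or> l = j") auto
    qed (use e ek in auto)
  qed (use ek in auto)
qed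

lemma steiner_independent_card:
  assumes S: "steiner_triple_system m S" and I: "I \<subseteq> {1..m}"
    and indep: "\<And>e. e \<in> edges S \<Longrightarrow> \<not> e \<subseteq> I"
  shows "2 * card I \<le> m + 1"
proof (cases "I = {}")
  case False
  then obtain i where i: "i \<in> I" by blast
  have fin: "finite I" using I finite_subset by blast
  have "\<exists>k. k \<in> {1..m} - I \<and> k \<noteq> i \<and> {i, j, k} \<in> edges S" if "j \<in> I - {i}" for j
  proof -
    have "i \<in> {1..m}" "j \<in> {1..m}" "i \<noteq> j" using that i I by auto
    then obtain k where k: "k \<in> {1..m}" "k \<noteq> i" "{i, j, k} \<in> edges S"
      by (metis steiner_third_point[OF S])
    then have "k \<notin> I" using indep[OF k(3)] that i by simp
    then show ?thesis using k by auto
  qed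
  then obtain f where f: "\<And>j. j \<in> I - {i} \<Longrightarrow> f j \<in> {1..m} - I \<and> f j \<noteq> i \<and> {i, j, f j} \<in> edges S"
    by metis
  have "inj_on f (I - {i})"
  proof (rule inj_onI)
    \<comment> \<open>The pair \<open>i\<close>, \<open>f j\<close> lies in a single triple, and
      both \<open>j\<close> and \<open>j'\<close> are its third point.\<close>
    fix j j' assume j: "j \<in> I - {i}" "j' \<in> I - {i}" "f j = f j'"
    have "i \<in> {1..m}" "f j \<in> {1..m}" "i \<noteq> f j" using f[OF j(1)] i I by auto
    then obtain k where "\<And>l. {i, f j, l} \<in> edges S \<longleftrightarrow> l = k"
      by (metis steiner_third_point[OF S])
    then show "j = j'" using f[OF j(1)] f[OF j(2)] j(3) by (metis insert_commute)
  qed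
  then have "card (I - {i}) \<le> card ({1..m} - I)"
    using f by (intro card_inj_on_le[where f = f]) auto
  then have "card I - 1 \<le> m - card I"
    using i fin I by (simp add: card_Diff_subset)
  \<comment> \<open>The natural subtraction \<open>m - card I\<close> truncates, so this bound is
    required before rearranging.\<close>
  moreover have "card I \<le> m" using card_mono[OF _ I] by simp
  ultimately show ?thesis by linarith
qed simp

section \<open>Edges of the blow-up in terms of part indices\<close>

text \<open>Disjointness and covering turn the parts into the fibres of an index function
  \<open>p\<close>, so that being an edge depends only on the image of a triple under
  \<open>p\<close>.\<close>

lemma balanced_partition_index:
  assumes "balanced_partition n m V"
  obtains p where "\<And>x. x \<in> {1..n} \<Longrightarrow> p x \<in> {1..m}"
    and "\<And>x i. i \<in> {1..m} \<Longrightarrow> x \<in> V i \<longleftrightarrow> x \<in> {1..n} \<and> p x = i"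
proof -
  have U: "(\<Union>i\<in>{1..m}. V i) = {1..n}"
    and D: "\<And>i j x. \<lbrakk>i \<in> {1..m}; j \<in> {1..m}; x \<in> V i; x \<in> V j\<rbrakk> \<Longrightarrow> i = j"
    using assms unfolding balanced_partition_def disjoint_family_on_def by blast+
  then have "\<forall>x\<in>{1..n}. \<exists>i\<in>{1..m}. x \<in> V i" by blast
  then obtain p where "\<And>x. x \<in> {1..n} \<Longrightarrow> p x \<in> {1..m} \<and> x \<in> V (p x)" by metis
  then show thesis using U D by (intro that[of p]) blast+
qed

lemma steiner_blowup_edge_iff:
  assumes p: "\<And>x. x \<in> {1..n} \<Longrightarrow> p x \<in> {1..m}"
    and V: "\<And>x i. i \<in> {1..m} \<Longrightarrow> x \<in> V i \<longleftrightarrow> x \<in> {1..n} \<and> p x = i"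
    and xyz: "x \<in> {1..n}" "y \<in> {1..n}" "z \<in> {1..n}" "x \<noteq> y" "x \<noteq> z" "y \<noteq> z"
  shows "{x, y, z} \<in> edges (steiner_blowup m S n V) \<longleftrightarrow>
    card (p ` {x, y, z}) \<noteq> 1 \<and> p ` {x, y, z} \<notin> {e \<in> edges S. card e = 3}"
    (is "_ \<longleftrightarrow> ?R {x, y, z}")
proof
  assume "{x, y, z} \<in> edges (steiner_blowup m S n V)"
  then consider
      (two) a b c where "{x, y, z} = {a, b, c}" "p a = p b" "p a \<noteq> p c"
    | (three) a b c where "{x, y, z} = {a, b, c}" "p a \<noteq> p b" "p a \<noteq> p c" "p b \<noteq> p c"
        "{p a, p b, p c} \<notin> edges S"
    unfolding steiner_blowup_def by (auto simp: V)
  then show "?R {x, y, z}"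
  proof cases
    case two
    have "?R {a, b, c}" using two(2,3) by simp
    then show ?thesis using two(1) by simp
  next
    case three
    have "?R {a, b, c}" using three(2-) by simp
    then show ?thesis using three(1) by simp
  qed
next
  assume R: "?R {x, y, z}"
  have two: "{a, b, c} \<in> edges (steiner_blowup m S n V)"
    if "a \<in> {1..n}" "b \<in> {1..n}" "c \<in> {1..n}" "a \<noteq> b" "p a = p b" "p a \<noteq> p c" for a b c
  proof -
    have "p a \<in> {1..m}" "p c \<in> {1..m}" "a \<in> V (p a)" "b \<in> V (p a)" "c \<in> V (p c)"
      using that p V by simp_all
    then show ?thesis using that(4,6) unfolding steiner_blowup_def snd_conv by blast
  qed
  have three: "{x, y, z} \<in> edges (steiner_blowup m S n V)"
    if "p x \<noteq> p y" "p x \<noteq> p z" "p y \<noteq> p z"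
  proof -
    have "{p x, p y, p z} \<notin> edges S" using R that by simp
    moreover have "p x \<in> {1..m}" "p y \<in> {1..m}" "p z \<in> {1..m}"
      "x \<in> V (p x)" "y \<in> V (p y)" "z \<in> V (p z)"
      using xyz p V by simp_all
    ultimately show ?thesis using that unfolding steiner_blowup_def snd_conv by blast
  qed
  show "{x, y, z} \<in> edges (steiner_blowup m S n V)"
  \<comment> \<open>\<open>two\<close> expects the vertices of the shared part first, so the triple
    is reordered according to which pair shares a part.\<close>
  proof (cases "p x = p y")
    case True
    then have "p x \<noteq> p z" using R by auto
    then show ?thesis using two[of x y z] xyz True by blast
  next
    case xy: False
    show ?thesis
    proof (cases "p x = p z")
      case True
      then have "{x, z, y} \<in> edges (steiner_blowup m S n V)" using two xyz xy by blast
      then show ?thesis by (simp add: insert_commute)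
    next
      case False
      show ?thesis
      proof (cases "p y = p z")
        case True
        then have "{y, z, x} \<in> edges (steiner_blowup m S n V)" using two xyz xy by metis
        then show ?thesis by (simp add: insert_commute)
      qed (use three xy False in blast)
    qed
  qed
qed

section \<open>Cliques of the blow-up\<close>

lemma steiner_blowup_clique_free:
  assumes S: "steiner_triple_system m S" and "balanced_partition n m V" and s: "m + 2 \<le> s"
  shows "clique_free s (steiner_blowup m S n V)"
  unfolding clique_free_def
proof
  obtain p where p: "\<And>x. x \<in> {1..n} \<Longrightarrow> p x \<in> {1..m}"
    and V: "\<And>x i. i \<in> {1..m} \<Longrightarrow> x \<in> V i \<longleftrightarrow> x \<in> {1..n} \<and> p x = i"
    using balanced_partition_index[OF assms(2)] by metis
  let ?G = "steiner_blowup m S n V"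
  assume "\<exists>A. A \<subseteq> verts ?G \<and> finite A \<and> card A = s \<and> (\<forall>T. T \<subseteq> A \<and> card T = 3 \<longrightarrow> T \<in> edges ?G)"
  then obtain A where A: "A \<subseteq> {1..n}" "finite A" "card A = s"
    and clq: "\<And>T. T \<subseteq> A \<Longrightarrow> card T = 3 \<Longrightarrow> T \<in> edges ?G"
    unfolding steiner_blowup_def fst_conv by blast
  have R: "card (p ` T) \<noteq> 1 \<and> p ` T \<notin> {e \<in> edges S. card e = 3}" if T: "T \<subseteq> A" "card T = 3" for T
  proof -
    obtain x y z where "T = {x, y, z}" "x \<noteq> y" "x \<noteq> z" "y \<noteq> z"
      using T(2) by (auto simp: card_3_iff)
    then show ?thesis
      using steiner_blowup_edge_iff[OF p V, of x y z S] clq[OF T] T(1) A(1) by blast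
  qed
  have le2: "card {x \<in> A. p x = i} \<le> 2" for i
  proof (rule ccontr)
    assume "\<not> ?thesis"
    then obtain T where T: "T \<subseteq> {x \<in> A. p x = i}" "card T = 3"
      using obtain_subset_with_card_n[of 3 "{x \<in> A. p x = i}"]
      by (metis not_less_eq_eq numeral_2_eq_2 numeral_3_eq_3)
    \<comment> \<open>Three clique vertices in one part would form a triple with a one-element
      image, which \<open>R\<close> forbids.\<close>
    then have "p ` T = {i}" by (auto simp: card_3_iff)
    then show False using R[of T] T by auto
  qed
  \<comment> \<open>The clique is counted by its fibres over the parts that it meets.\<close>
  have "card A = (\<Sum>i\<in>p ` A. card {x \<in> A. p x = i})"
    using A(2) by (subst card_UN_disjoint[symmetric]) (auto intro: arg_cong[where f = card])
  also have "\<dots> \<le> (\<Sum>i\<in>p ` A. 2)" by (intro sum_mono le2)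
  finally have "s \<le> 2 * card (p ` A)" using A(3) by simp
  moreover have "2 * card (p ` A) \<le> m + 1"
  proof (rule steiner_independent_card[OF S])
    show "p ` A \<subseteq> {1..m}" using p A(1) by blast
    fix e assume e: "e \<in> edges S"
    then have c: "card e = 3" using S unfolding steiner_triple_system_def three_graph_def by blast
    show "\<not> e \<subseteq> p ` A"
    proof
      assume "e \<subseteq> p ` A"
      \<comment> \<open>A triple of \<open>S\<close> among the parts met by \<open>A\<close> is
        lifted by choosing one clique vertex in each of its three parts. The lift is a non-edge
        inside the clique.\<close>
      then obtain T where "T \<subseteq> A" "inj_on p T" "e = p ` T" by (auto simp: subset_image_inj)
      then show False using R[of T] e c by (auto simp: card_image)
    qed
  qed
  ultimately show False using s by linarith
qed

section \<open>Codegrees of the blow-up\<close>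

text \<open>An edge through \<open>x\<close> and \<open>y\<close> is determined by its third vertex,
  so counting edges becomes counting vertices.\<close>

lemma codegree_eq_card_link:
  assumes "three_graph G" "x \<noteq> y"
  shows "codegree G x y = card {z \<in> verts G - {x, y}. {x, y, z} \<in> edges G}"
proof -
  have inj: "inj_on (\<lambda>z. {x, y, z}) {z \<in> verts G - {x, y}. {x, y, z} \<in> edges G}"
    by (auto simp: inj_on_def)
  have "{e \<in> edges G. x \<in> e \<and> y \<in> e}
      = (\<lambda>z. {x, y, z}) ` {z \<in> verts G - {x, y}. {x, y, z} \<in> edges G}" (is "?L = ?R")
  proof
    show "?L \<subseteq> ?R"
    proof
      fix e assume e: "e \<in> ?L"
      then have E: "e \<subseteq> verts G" "card e = 3" using assms(1) unfolding three_graph_def by auto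
      have "card (e - {x, y}) = 1" using e E assms(2) by (simp add: card_Diff_subset)
      then obtain z where "e - {x, y} = {z}" by (auto simp: card_1_singleton_iff)
      then have "e = {x, y, z}" "z \<in> verts G - {x, y}" using e E by auto
      then show "e \<in> ?R" using e by blast
    qed
  qed auto
  then show ?thesis unfolding codegree_def by (simp only: card_image[OF inj])
qed

text \<open>The slack of 2 unites both cases: if \<open>x\<close> and \<open>y\<close> share a part,
  then \<open>V k\<close> is that part and the sum is exactly \<open>n\<close>; otherwise neither
  vertex lies in \<open>V k\<close> and the sum is \<open>n - 2\<close>.\<close>

lemma steiner_blowup_codegree:
  assumes S: "steiner_triple_system m S" and B: "balanced_partition n m V"
    and xy: "x \<in> {1..n}" "y \<in> {1..n}" "x \<noteq> y"
  obtains k where "k \<in> {1..m}"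
    "codegree (steiner_blowup m S n V) x y + card (V k) \<le> n"
    "n \<le> codegree (steiner_blowup m S n V) x y + card (V k) + 2"
proof -
  obtain p where p: "\<And>x. x \<in> {1..n} \<Longrightarrow> p x \<in> {1..m}"
    and V: "\<And>x i. i \<in> {1..m} \<Longrightarrow> x \<in> V i \<longleftrightarrow> x \<in> {1..n} \<and> p x = i"
    using balanced_partition_index[OF B] by metis
  let ?G = "steiner_blowup m S n V"
  have iff: "{x, y, z} \<in> edges ?G \<longleftrightarrow>
      card (p ` {x, y, z}) \<noteq> 1 \<and> p ` {x, y, z} \<notin> {e \<in> edges S. card e = 3}"
    if "z \<in> {1..n} - {x, y}" for z
    using that xy by (intro steiner_blowup_edge_iff[OF p V]) auto
  have "\<exists>k\<in>{1..m}. \<forall>z\<in>{1..n} - {x, y}. {x, y, z} \<in> edges ?G \<longleftrightarrow> p z \<noteq> k"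
  proof (cases "p x = p y")
    case True
    have "{x, y, z} \<in> edges ?G \<longleftrightarrow> p z \<noteq> p x" if "z \<in> {1..n} - {x, y}" for z
      unfolding iff[OF that] using True by (simp add: card_insert_if)
    then show ?thesis using p[OF xy(1)] by blast
  next
    case False
    obtain k where k: "k \<in> {1..m}" "k \<noteq> p x" "k \<noteq> p y"
      "\<And>l. {p x, p y, l} \<in> edges S \<longleftrightarrow> l = k"
      using steiner_third_point[OF S p[OF xy(1)] p[OF xy(2)] False] by blast
    have "{x, y, z} \<in> edges ?G \<longleftrightarrow> p z \<noteq> k" if "z \<in> {1..n} - {x, y}" for z
      unfolding iff[OF that] using False k by (simp add: card_insert_if)
    then show ?thesis using k(1) by blast
  qed
  then obtain k where k: "k \<in> {1..m}"
    and E: "\<And>z. z \<in> {1..n} - {x, y} \<Longrightarrow> {x, y, z} \<in> edges ?G \<longleftrightarrow> p z \<noteq> k" by blast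
  define Z where "Z = {z \<in> {1..n} - {x, y}. {x, y, z} \<in> edges ?G}"
  have cZ: "codegree ?G x y = card Z"
    using codegree_eq_card_link[OF three_graph_steiner_blowup[OF B] xy(3)]
    by (simp add: Z_def steiner_blowup_def)
  have sub: "V k \<subseteq> {1..n}" and finV: "finite (V k)"
    using V[OF k] by (auto intro: finite_subset[of _ "{1..n}"])
  have disj: "Z \<inter> V k = {}" and finZ: "finite Z" and Zn: "Z \<subseteq> {1..n}"
    using V[OF k] E by (auto simp: Z_def)
  have cov: "{1..n} \<subseteq> (Z \<union> V k) \<union> {x, y}"
    using V[OF k] E unfolding Z_def by blast
  have eq: "card (Z \<union> V k) = card Z + card (V k)"
    using card_Un_disjoint[OF finZ finV disj] .
  have "card (Z \<union> V k) \<le> n"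
    using card_mono[of "{1..n}" "Z \<union> V k"] Zn sub by simp
  moreover have "n \<le> card (Z \<union> V k) + 2"
  proof -
    have "n \<le> card ((Z \<union> V k) \<union> {x, y})"
      using card_mono[OF _ cov] finZ finV by simp
    also have "\<dots> \<le> card (Z \<union> V k) + card {x, y}" by (rule card_Un_le)
    finally show ?thesis using xy(3) by simp
  qed
  ultimately show thesis using that[OF k] cZ eq by simp
qed

text \<open>The balance condition between \<open>V k\<close> and each part is summed over all parts.
  After division by \<open>m\<close>, the size of \<open>V k\<close> differs from
  \<open>n / m\<close> by at most 1.\<close>

lemma balanced_partition_part_card:
  assumes B: "balanced_partition n m V" and k: "k \<in> {1..m}"
  shows "m * card (V k) \<le> n + m" and "n \<le> m * card (V k) + m"
proof -
  have U: "(\<Union>i\<in>{1..m}. V i) = {1..n}" and D: "disjoint_family_on V {1..m}"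
    and le: "\<And>i j. \<lbrakk>i \<in> {1..m}; j \<in> {1..m}\<rbrakk> \<Longrightarrow> card (V i) \<le> card (V j) + 1"
    using B unfolding balanced_partition_def by blast+
  have fin: "finite (V i)" if "i \<in> {1..m}" for i
    using U that by (intro finite_subset[of "V i" "{1..n}"]) auto
  have n: "n = (\<Sum>i\<in>{1..m}. card (V i))"
  proof -
    have "card (\<Union>i\<in>{1..m}. V i) = (\<Sum>i\<in>{1..m}. card (V i))"
      using D fin by (intro card_UN_disjoint) (auto simp: disjoint_family_on_def)
    then show ?thesis unfolding U by simp
  qed
  have "(\<Sum>i\<in>{1..m}. card (V k)) \<le> (\<Sum>i\<in>{1..m}. card (V i) + 1)"
    by (intro sum_mono le k)
  then show "m * card (V k) \<le> n + m" by (simp add: n sum_Suc)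
  have "(\<Sum>i\<in>{1..m}. card (V i)) \<le> (\<Sum>i\<in>{1..m}. card (V k) + 1)"
    by (intro sum_mono le k)
  then show "n \<le> m * card (V k) + m" by (simp add: n)
qed

text \<open>The error 3 is the slack 2 from the codegree estimate plus the deviation 1 of a part
  size from \<open>n / m\<close>.\<close>

lemma steiner_blowup_min_codegree:
  assumes S: "steiner_triple_system m S" and B: "balanced_partition n m V" and n: "2 \<le> n"
  shows "\<bar>real (min_codegree (steiner_blowup m S n V)) - (1 - 1 / real m) * real n\<bar> \<le> 3"
proof -
  let ?G = "steiner_blowup m S n V"
  let ?D = "{codegree ?G x y | x y. x \<in> verts ?G \<and> y \<in> verts ?G \<and> x \<noteq> y}"
  have vG: "verts ?G = {1..n}" by (simp add: steiner_blowup_def)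
  have "?D \<subseteq> (\<lambda>(x, y). codegree ?G x y) ` ({1..n} \<times> {1..n})" unfolding vG by auto
  then have "finite ?D" by (rule finite_subset) simp
  \<comment> \<open>Since \<open>2 \<le> n\<close>, the vertices 1 and 2 exist; hence the minimum is
    over a nonempty set and is attained by some pair.\<close>
  moreover have "codegree ?G 1 2 \<in> ?D" unfolding vG using n by force
  ultimately have "min_codegree ?G \<in> ?D" unfolding min_codegree_def by (intro Min_in) auto
  then obtain x y where "x \<in> {1..n}" "y \<in> {1..n}" "x \<noteq> y"
    and mc: "min_codegree ?G = codegree ?G x y"
    unfolding vG by blast
  then obtain k where k: "k \<in> {1..m}" "min_codegree ?G + card (V k) \<le> n"
    "n \<le> min_codegree ?G + card (V k) + 2"
    using steiner_blowup_codegree[OF S B] by metis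
  have m: "real m > 0" using k(1) by simp
  have "real (m * card (V k)) \<le> real (n + m)" "real n \<le> real (m * card (V k) + m)"
    using balanced_partition_part_card[OF B k(1)] by (simp_all only: of_nat_le_iff)
  then have "real (card (V k)) \<le> real n / real m + 1" "real n / real m \<le> real (card (V k)) + 1"
    using m by (simp_all add: field_simps)
  moreover have "(1 - 1 / real m) * real n = real n - real n / real m" by (simp add: algebra_simps)
  ultimately show ?thesis using k(2,3) by linarith
qed

theorem proposition7:
  fixes s :: nat
  assumes "s \<ge> 5" and "s mod 6 = 3 \<or> s mod 6 = 5"
  shows "(\<forall>S n V. steiner_triple_system (s - 2) S \<longrightarrow> balanced_partition n (s - 2) V \<longrightarrow>
            clique_free s (steiner_blowup (s - 2) S n V)) \<and>
         (\<exists>C::real. \<forall>S n V. steiner_triple_system (s - 2) S \<longrightarrow> balanced_partition n (s - 2) V \<longrightarrow>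
            n \<ge> 2 \<longrightarrow>
            \<bar>real (min_codegree (steiner_blowup (s - 2) S n V))
               - (1 - 1 / (real s - 2)) * real n\<bar> \<le> C)"
proof -
  \<comment> \<open>The bound \<open>s \<ge> 5\<close> ensures that the natural subtraction
    \<open>s - 2\<close> does not truncate.\<close>
  have m: "real s - 2 = real (s - 2)" "s - 2 + 2 \<le> s" using assms(1) by auto
  show ?thesis
    unfolding m(1)
    \<comment> \<open>The constant is \<open>C = 3\<close>, the same for every
      \<open>s\<close>.\<close>
    using steiner_blowup_clique_free[OF _ _ m(2)] steiner_blowup_min_codegree by blast
qed

end
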